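(* The following statement (ACSC) implies the statement (FC for kernels). (ACSC) For every complete Nevanlinna--Pick space $\mathcal H$ on a set $\Omega$ and every sequence $\Lambda=(\lambda_n)_{n\geq 1}$ in $\Omega$: if $\Lambda$ is separated and the measure $\mu_\Lambda=\sum_{n\geq 1}\|k_{\lambda_n}\|^{-2}\delta_{\lambda_n}$ is a Carleson measure for $\mathcal H$, then $\Lambda$ is an interpolating sequence for $\mathcal H$. (FC for kernels) For every complete Nevanlinna--Pick space $\mathcal H$ on a set $\Omega$ and every sequence $(\lambda_n)_{n\ge1}$ in $\Omega$: if the sequence of normalized reproducing kernels $(\widehat k_{\lambda_n})_{n\ge1}$ is a Bessel sequence in $\mathcal H$, then it can be partitioned into finitely many Riesz sequences.
   Context: Let $\mathcal H$ be a (complex) Hilbert space of functions on a set $\Omega$ such that evaluation at each point of $\Omega$ is a non-zero continuous functional on $\mathcal H$. For $\lambda\in\Omega$, $k_\lambda\in\mathcal H$ denotes the reproducing kernel, i.e. $f(\lambda)=\langle f,k_\lambda\rangle$ for all $f\in\mathcal H$, and $\widehat k_\lambda=k_\lambda/\|k_\lambda\|$ is the normalized reproducing kernel. $\mathcal H$ is a complete Nevanlinna--Pick space if (a) $k_\lambda(z)\ne0$ for all $\lambda,z\in\Omega$, and (b) there exists $\omega_0\in\Omega$ such that the function $$(z,\lambda)\mapsto 1-\frac{k_{\omega_0}(z)k_{\lambda}(\omega_0)}{k_{\omega_0}(\omega_0)k_{\lambda}(z)}$$ is positive definite on $\Omega\times\Omega$ (i.e. all matrices obtained from finitely many points of $\Omega$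 are positive semidefinite). A (finite or countable) family $(x_n)_{n\in I}$ in $\mathcal H$ is a Riesz sequence if there are constants $A,B>0$ such that $A\sum |a_n|^2\leq \| \sum a_n x_n\|^2\leq B\sum |a_n|^2$ for all finitely supported complex families $(a_n)_{n\in I}$; it is a Bessel sequence if (at least) the right-hand inequality holds for some $B>0$. A sequence $\Lambda=(\lambda_n)_{n\ge1}$ in $\Omega$ is interpolating for $\mathcal H$ if $(\widehat k_{\lambda_n})_{n\ge1}$ is a Riesz sequence; it is separated if there is $\gamma<1$ with $|\langle \widehat k_{\lambda_n},\widehat k_{\lambda_m}\rangle|\le\gamma$ for all $n\ne m$. A measure $\mu$ on $\Omega$ is a Carleson measure for $\mathcal H$ if $\mathcal H\subset L^2(\mu)$. $\delta_\lambda$ is the Dirac measure at $\lambda$. "Can be partitioned into finitely many Riesz sequences" means that the index set $\{1,2,3,\dots\}$ is a union of finitely many pairwise disjoint subsets $I_1,\dots,I_r$ such that each subfamily indexed by $I_j$ is a Riesz sequence. *)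

theory Defs
  imports "HOL-Analysis.Analysis" "HOL-Probability.Giry_Monad"
begin

definition hnorm :: "(('a \<Rightarrow> complex) \<Rightarrow> ('a \<Rightarrow> complex) \<Rightarrow> complex) \<Rightarrow> ('a \<Rightarrow> complex) \<Rightarrow> real" where
  "hnorm ip f = sqrt (Re (ip f f))"

text \<open>The inner product is only specified on \<open>H\<close>, whereas the locale \<open>Metric_space\<close>
  asks for a distance that is symmetric and nonnegative on the whole type; hence the
  value 0 off \<open>H\<close>.\<close>

definition hdist ::
  "('a \<Rightarrow> complex) set \<Rightarrow> (('a \<Rightarrow> complex) \<Rightarrow> ('a \<Rightarrow> complex) \<Rightarrow> complex)
    \<Rightarrow> ('a \<Rightarrow> complex) \<Rightarrow> ('a \<Rightarrow> complex) \<Rightarrow> real" where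
  "hdist H ip f g = (if f \<in> H \<and> g \<in> H then hnorm ip (\<lambda>z. f z - g z) else 0)"

text \<open>Functions on the set \<open>\<Omega>\<close> are represented by functions on the ambient type that
  vanish off \<open>\<Omega>\<close>. The inner product is linear in its first argument.\<close>

locale hilbert_function_space =
  fixes \<Omega> :: "'a set"
    and H :: "('a \<Rightarrow> complex) set"
    and ip :: "('a \<Rightarrow> complex) \<Rightarrow> ('a \<Rightarrow> complex) \<Rightarrow> complex"
  assumes vanish_off: "\<And>f z. f \<in> H \<Longrightarrow> z \<notin> \<Omega> \<Longrightarrow> f z = 0"
    and zero_mem: "(\<lambda>z. 0) \<in> H"
    and add_mem: "\<And>f g. f \<in> H \<Longrightarrow> g \<in> H \<Longrightarrow> (\<lambda>z. f z + g z) \<in> H"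
    and scale_mem: "\<And>c f. f \<in> H \<Longrightarrow> (\<lambda>z. c * f z) \<in> H"
    and ip_add: "\<And>f g h. f \<in> H \<Longrightarrow> g \<in> H \<Longrightarrow> h \<in> H \<Longrightarrow>
          ip (\<lambda>z. f z + g z) h = ip f h + ip g h"
    and ip_scale: "\<And>c f h. f \<in> H \<Longrightarrow> h \<in> H \<Longrightarrow> ip (\<lambda>z. c * f z) h = c * ip f h"
    and ip_cnj: "\<And>f g. f \<in> H \<Longrightarrow> g \<in> H \<Longrightarrow> ip g f = cnj (ip f g)"
    and ip_nonneg: "\<And>f. f \<in> H \<Longrightarrow> 0 \<le> Re (ip f f)"
    and ip_definite: "\<And>f. f \<in> H \<Longrightarrow> ip f f = 0 \<Longrightarrow> f = (\<lambda>z. 0)"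
    and complete: "Metric_space.mcomplete H (hdist H ip)"
    and eval_continuous: "\<And>w. w \<in> \<Omega> \<Longrightarrow>
          continuous_map (Metric_space.mtopology H (hdist H ip)) euclidean (\<lambda>f. f w)"
    and eval_nonzero: "\<And>w. w \<in> \<Omega> \<Longrightarrow> \<exists>f\<in>H. f w \<noteq> 0"

definition rkernel ::
  "('a \<Rightarrow> complex) set \<Rightarrow> (('a \<Rightarrow> complex) \<Rightarrow> ('a \<Rightarrow> complex) \<Rightarrow> complex)
    \<Rightarrow> 'a \<Rightarrow> 'a \<Rightarrow> complex" where
  "rkernel H ip w = (THE k. k \<in> H \<and> (\<forall>f\<in>H. f w = ip f k))"

definition nkernel ::
  "('a \<Rightarrow> complex) set \<Rightarrow> (('a \<Rightarrow> complex) \<Rightarrow> ('a \<Rightarrow> complex) \<Rightarrow> complex)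
    \<Rightarrow> 'a \<Rightarrow> 'a \<Rightarrow> complex" where
  "nkernel H ip w = (\<lambda>z. rkernel H ip w z / of_real (hnorm ip (rkernel H ip w)))"

definition pos_def_on :: "'a set \<Rightarrow> ('a \<Rightarrow> 'a \<Rightarrow> complex) \<Rightarrow> bool" where
  "pos_def_on \<Omega> K \<longleftrightarrow>
    (\<forall>(N::nat) (p :: nat \<Rightarrow> 'a) (c :: nat \<Rightarrow> complex). (\<forall>i<N. p i \<in> \<Omega>) \<longrightarrow>
      (\<Sum>i<N. \<Sum>j<N. cnj (c i) * K (p i) (p j) * c j) \<in> \<real>\<^sub>\<ge>\<^sub>0)"

definition complete_NP_space ::
  "'a set \<Rightarrow> ('a \<Rightarrow> complex) set \<Rightarrow> (('a \<Rightarrow> complex) \<Rightarrow> ('a \<Rightarrow> complex) \<Rightarrow> complex) \<Rightarrow> bool" where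
  "complete_NP_space \<Omega> H ip \<longleftrightarrow>
    hilbert_function_space \<Omega> H ip \<and>
    (\<forall>w\<in>\<Omega>. \<forall>z\<in>\<Omega>. rkernel H ip w z \<noteq> 0) \<and>
    (\<exists>w0\<in>\<Omega>. pos_def_on \<Omega> (\<lambda>z w.
       1 - (rkernel H ip w0 z * rkernel H ip w w0) / (rkernel H ip w0 w0 * rkernel H ip w z)))"

definition riesz_sequence ::
  "(('a \<Rightarrow> complex) \<Rightarrow> ('a \<Rightarrow> complex) \<Rightarrow> complex) \<Rightarrow> 'i set \<Rightarrow> ('i \<Rightarrow> 'a \<Rightarrow> complex) \<Rightarrow> bool" where
  "riesz_sequence ip I x \<longleftrightarrow>
    (\<exists>A>0. \<exists>B>0. \<forall>a :: 'i \<Rightarrow> complex. finite {n\<in>I. a n \<noteq> 0} \<longrightarrow>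
      A * (\<Sum>n | n \<in> I \<and> a n \<noteq> 0. (cmod (a n))\<^sup>2)
        \<le> (hnorm ip (\<lambda>z. \<Sum>n | n \<in> I \<and> a n \<noteq> 0. a n * x n z))\<^sup>2 \<and>
      (hnorm ip (\<lambda>z. \<Sum>n | n \<in> I \<and> a n \<noteq> 0. a n * x n z))\<^sup>2
        \<le> B * (\<Sum>n | n \<in> I \<and> a n \<noteq> 0. (cmod (a n))\<^sup>2))"

definition bessel_sequence ::
  "(('a \<Rightarrow> complex) \<Rightarrow> ('a \<Rightarrow> complex) \<Rightarrow> complex) \<Rightarrow> 'i set \<Rightarrow> ('i \<Rightarrow> 'a \<Rightarrow> complex) \<Rightarrow> bool" where
  "bessel_sequence ip I x \<longleftrightarrow>
    (\<exists>B>0. \<forall>a :: 'i \<Rightarrow> complex. finite {n\<in>I. a n \<noteq> 0} \<longrightarrow>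
      (hnorm ip (\<lambda>z. \<Sum>n | n \<in> I \<and> a n \<noteq> 0. a n * x n z))\<^sup>2
        \<le> B * (\<Sum>n | n \<in> I \<and> a n \<noteq> 0. (cmod (a n))\<^sup>2))"

definition interpolating ::
  "('a \<Rightarrow> complex) set \<Rightarrow> (('a \<Rightarrow> complex) \<Rightarrow> ('a \<Rightarrow> complex) \<Rightarrow> complex)
    \<Rightarrow> (nat \<Rightarrow> 'a) \<Rightarrow> bool" where
  "interpolating H ip \<Lambda> \<longleftrightarrow> riesz_sequence ip UNIV (\<lambda>n. nkernel H ip (\<Lambda> n))"

definition separated_sequence ::
  "('a \<Rightarrow> complex) set \<Rightarrow> (('a \<Rightarrow> complex) \<Rightarrow> ('a \<Rightarrow> complex) \<Rightarrow> complex)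
    \<Rightarrow> (nat \<Rightarrow> 'a) \<Rightarrow> bool" where
  "separated_sequence H ip \<Lambda> \<longleftrightarrow>
    (\<exists>\<gamma><1. \<forall>n m. n \<noteq> m \<longrightarrow> cmod (ip (nkernel H ip (\<Lambda> n)) (nkernel H ip (\<Lambda> m))) \<le> \<gamma>)"

definition carleson_measure :: "('a \<Rightarrow> complex) set \<Rightarrow> 'a measure \<Rightarrow> bool" where
  "carleson_measure H \<mu> \<longleftrightarrow>
    (\<forall>f\<in>H. f \<in> borel_measurable \<mu> \<and> integrable \<mu> (\<lambda>z. (cmod (f z))\<^sup>2))"

text \<open>A countable sum of point masses, as a measure on all subsets of \<open>\<Omega>\<close>;
  \<open>return\<close> is the Dirac measure.\<close>

definition kernel_measure ::
  "'a set \<Rightarrow> ('a \<Rightarrow> complex) set \<Rightarrow> (('a \<Rightarrow> complex) \<Rightarrow> ('a \<Rightarrow> complex) \<Rightarrow> complex)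
    \<Rightarrow> (nat \<Rightarrow> 'a) \<Rightarrow> 'a measure" where
  "kernel_measure \<Omega> H ip \<Lambda> = measure_of \<Omega> (Pow \<Omega>)
    (\<lambda>A. \<Sum>n. ennreal (1 / (hnorm ip (rkernel H ip (\<Lambda> n)))\<^sup>2)
                * emeasure (return (count_space \<Omega>) (\<Lambda> n)) A)"

definition finite_union_of_riesz ::
  "(('a \<Rightarrow> complex) \<Rightarrow> ('a \<Rightarrow> complex) \<Rightarrow> complex) \<Rightarrow> (nat \<Rightarrow> 'a \<Rightarrow> complex) \<Rightarrow> bool" where
  "finite_union_of_riesz ip x \<longleftrightarrow>
    (\<exists>(r::nat) (I :: nat \<Rightarrow> nat set). (\<Union>j<r. I j) = UNIV \<and> disjoint_family_on I {..<r} \<and>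
      (\<forall>j<r. riesz_sequence ip (I j) x))"

end

theory Submission
  imports Defs
begin

text \<open>The Bessel bound \<open>B\<close> gives \<open>(\<Sum>m. \<bar>\<langle>k\<^sub>n, k\<^sub>m\<rangle>\<bar>\<^sup>2) \<le> B\<close> for the normalized kernels, so for
  each \<open>n\<close> at most \<open>4 B\<close> indices \<open>m\<close> satisfy \<open>\<bar>\<langle>k\<^sub>n, k\<^sub>m\<rangle>\<bar> > 1/2\<close>. A greedy colouring of this
  graph of bounded degree splits the sequence into finitely many separated ones. By the
  reproducing property the Bessel bound is also the Carleson condition, and it is inherited by
  subsequences, so ACSC applies to each infinite colour class.\<close>

context hilbert_function_space
begin

section \<open>Inner product algebra and the norm it induces\<close>

lemma diff_mem: "f \<in> H \<Longrightarrow> g \<in> H \<Longrightarrow> (\<lambda>z. f z - g z) \<in> H"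
  using add_mem[of f "\<lambda>z. (-1) * g z"] scale_mem[of g "-1"] by simp

lemma ip_diff: "f \<in> H \<Longrightarrow> g \<in> H \<Longrightarrow> h \<in> H \<Longrightarrow> ip (\<lambda>z. f z - g z) h = ip f h - ip g h"
  using ip_add[of f "\<lambda>z. (-1) * g z" h] ip_scale[of g h "-1"] scale_mem[of g "-1"] by simp

lemma ip_add_right:
  "f \<in> H \<Longrightarrow> g \<in> H \<Longrightarrow> h \<in> H \<Longrightarrow> ip h (\<lambda>z. f z + g z) = ip h f + ip h g"
  by (simp only: ip_cnj[of "\<lambda>z. f z + g z" h] add_mem ip_add ip_cnj[of f h] ip_cnj[of g h]
      complex_cnj_add)

lemma ip_diff_right:
  "f \<in> H \<Longrightarrow> g \<in> H \<Longrightarrow> h \<in> H \<Longrightarrow> ip h (\<lambda>z. f z - g z) = ip h f - ip h g"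
  by (simp only: ip_cnj[of "\<lambda>z. f z - g z" h] diff_mem ip_diff ip_cnj[of f h] ip_cnj[of g h]
      complex_cnj_diff)

lemma ip_scale_right: "f \<in> H \<Longrightarrow> h \<in> H \<Longrightarrow> ip h (\<lambda>z. c * f z) = cnj c * ip h f"
  by (simp only: ip_cnj[of "\<lambda>z. c * f z" h] scale_mem ip_scale ip_cnj[of f h] complex_cnj_mult)

lemma ip_zero_left: "h \<in> H \<Longrightarrow> ip (\<lambda>z. 0) h = 0"
  using ip_scale[of h h 0] by simp

lemma ip_zero_right: "h \<in> H \<Longrightarrow> ip h (\<lambda>z. 0) = 0"
  using ip_scale_right[of h h 0] by simp

lemma sum_mem_ip_sum:
  assumes "finite F" "\<And>n. n \<in> F \<Longrightarrow> x n \<in> H" "h \<in> H"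
  shows "(\<lambda>z. \<Sum>n\<in>F. a n * x n z) \<in> H \<and>
         ip (\<lambda>z. \<Sum>n\<in>F. a n * x n z) h = (\<Sum>n\<in>F. a n * ip (x n) h)"
  using assms
proof (induction F rule: finite_induct)
  case empty
  then show ?case using zero_mem by (simp add: ip_zero_left)
next
  case (insert n F)
  have 1: "(\<lambda>z. a n * x n z) \<in> H" using insert scale_mem by simp
  have 2: "(\<lambda>z. \<Sum>n\<in>F. a n * x n z) \<in> H" using insert by simp
  show ?case
    using add_mem[OF 1 2] ip_add[OF 1 2, of h] ip_scale[of "x n" h "a n"] insert by simp
qed

lemma ip_self: "f \<in> H \<Longrightarrow> ip f f = of_real (Re (ip f f))"
  using ip_cnj[of f f] by (simp add: complex_eq_iff)

lemma Re_ip_commute: "f \<in> H \<Longrightarrow> g \<in> H \<Longrightarrow> Re (ip g f) = Re (ip f g)"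
  using ip_cnj[of f g] by simp

lemma hnorm_power2: "f \<in> H \<Longrightarrow> (hnorm ip f)\<^sup>2 = Re (ip f f)"
  by (simp add: hnorm_def ip_nonneg)

lemma hnorm_nonneg: "f \<in> H \<Longrightarrow> 0 \<le> hnorm ip f"
  by (simp add: hnorm_def ip_nonneg)

lemma hnorm_eq_0: "f \<in> H \<Longrightarrow> hnorm ip f = 0 \<Longrightarrow> f = (\<lambda>z. 0)"
  using ip_definite[of f] ip_self[of f] hnorm_power2[of f] by auto

lemma ip_self_diff:
  assumes "f \<in> H" "g \<in> H"
  shows "Re (ip (\<lambda>z. f z - g z) (\<lambda>z. f z - g z)) = Re (ip f f) - 2 * Re (ip f g) + Re (ip g g)"
  using assms by (simp add: ip_diff ip_diff_right diff_mem Re_ip_commute[of f g])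

lemma ip_self_add:
  assumes "f \<in> H" "g \<in> H"
  shows "Re (ip (\<lambda>z. f z + g z) (\<lambda>z. f z + g z)) = Re (ip f f) + 2 * Re (ip f g) + Re (ip g g)"
  using assms by (simp add: ip_add ip_add_right add_mem Re_ip_commute[of f g])

text \<open>Expanding the square norm of \<open>b f - a g\<close>, with \<open>a\<close> and
  \<open>b\<close> the norms of \<open>f\<close> and \<open>g\<close>, gives
  \<open>2 a b (a b - Re (ip f g))\<close>, which is nonnegative. If \<open>a\<close> or
  \<open>b\<close> vanishes, so does the vector. The real part is all that the triangle inequality
  uses.\<close>

lemma Re_ip_le:
  assumes f: "f \<in> H" and g: "g \<in> H"
  shows "Re (ip f g) \<le> hnorm ip f * hnorm ip g"
proof -
  define a b where "a = hnorm ip f" and "b = hnorm ip g"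
  have a: "a \<ge> 0" "Re (ip f f) = a\<^sup>2" and b: "b \<ge> 0" "Re (ip g g) = b\<^sup>2"
    by (simp_all add: a_def b_def hnorm_nonneg hnorm_power2 f g)
  show ?thesis
  proof (cases "a = 0 \<or> b = 0")
    case True
    then have "ip f g = 0"
    proof
      assume "a = 0"
      then have "f = (\<lambda>z. 0)" unfolding a_def by (rule hnorm_eq_0[OF f])
      then show ?thesis using ip_zero_left[OF g] by simp
    next
      assume "b = 0"
      then have "g = (\<lambda>z. 0)" unfolding b_def by (rule hnorm_eq_0[OF g])
      then show ?thesis using ip_zero_right[OF f] by simp
    qed
    then show ?thesis by (simp add: hnorm_nonneg f g)
  next
    case False
    let ?F = "\<lambda>z. complex_of_real b * f z" and ?G = "\<lambda>z. complex_of_real a * g z"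
    have FG: "?F \<in> H" "?G \<in> H"
      by (rule scale_mem[OF f], rule scale_mem[OF g])
    have "0 \<le> Re (ip ?F ?F) - 2 * Re (ip ?F ?G) + Re (ip ?G ?G)"
      using ip_nonneg[OF diff_mem[OF FG]] ip_self_diff[OF FG] by simp
    also have "\<dots> = 2 * (a * b) * (a * b - Re (ip f g))"
      by (simp add: ip_scale[OF f FG(1)] ip_scale[OF f FG(2)] ip_scale[OF g FG(2)]
          ip_scale_right[OF f f] ip_scale_right[OF g f] ip_scale_right[OF g g] a(2) b(2))
        (simp add: algebra_simps power2_eq_square)
    finally have "0 \<le> (a * b) * (a * b - Re (ip f g))" by simp
    moreover have "a * b > 0" using False a b by auto
    ultimately show ?thesis by (simp add: zero_le_mult_iff a_def b_def)
  qed
qed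

lemma hnorm_triangle:
  assumes f: "f \<in> H" and g: "g \<in> H"
  shows "hnorm ip (\<lambda>z. f z + g z) \<le> hnorm ip f + hnorm ip g"
proof (rule power2_le_imp_le)
  have "(hnorm ip (\<lambda>z. f z + g z))\<^sup>2 = (hnorm ip f)\<^sup>2 + 2 * Re (ip f g) + (hnorm ip g)\<^sup>2"
    by (simp only: hnorm_power2[OF f] hnorm_power2[OF g] hnorm_power2[OF add_mem[OF f g]]
        ip_self_add[OF f g])
  then show "(hnorm ip (\<lambda>z. f z + g z))\<^sup>2 \<le> (hnorm ip f + hnorm ip g)\<^sup>2"
    using Re_ip_le[OF f g] by (simp add: power2_sum)
  show "0 \<le> hnorm ip f + hnorm ip g"
    using hnorm_nonneg[OF f] hnorm_nonneg[OF g] by simp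
qed

lemma hnorm_diff_commute:
  assumes "f \<in> H" "g \<in> H"
  shows "hnorm ip (\<lambda>z. f z - g z) = hnorm ip (\<lambda>z. g z - f z)"
  by (simp only: hnorm_def ip_self_diff[OF assms] ip_self_diff[OF assms(2,1)]
      Re_ip_commute[OF assms]) (simp add: algebra_simps)

section \<open>Hilbert space geometry and existence of reproducing kernels\<close>

lemma Metric_space_hdist: "Metric_space H (hdist H ip)"
proof
  fix f g h
  show "0 \<le> hdist H ip f g" by (simp add: hdist_def hnorm_nonneg diff_mem)
  show "hdist H ip f g = hdist H ip g f"
    unfolding hdist_def by (intro if_cong hnorm_diff_commute) auto
  show "hdist H ip f h \<le> hdist H ip f g + hdist H ip g h" if "f \<in> H" "g \<in> H" "h \<in> H"
    using hnorm_triangle[of "\<lambda>z. f z - g z" "\<lambda>z. g z - h z"] that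
    by (simp add: hdist_def diff_mem)
  show "hdist H ip f g = 0 \<longleftrightarrow> f = g" if "f \<in> H" "g \<in> H"
  proof
    assume "hdist H ip f g = 0"
    then have "(\<lambda>z. f z - g z) = (\<lambda>z. 0)" 
      by (intro hnorm_eq_0 diff_mem that) (use that in \<open>simp add: hdist_def\<close>)
    then show "f = g" by (auto simp: fun_eq_iff)
  next
    assume "f = g"
    then show "hdist H ip f g = 0" by (simp add: hdist_def hnorm_def ip_zero_left zero_mem)
  qed
qed

text \<open>Completeness and continuity of evaluation are assumed through
  \<open>Metric_space\<close>; this makes its lemmas on Cauchy sequences and limits available for
  them.\<close>

sublocale metric: Metric_space H "hdist H ip"
  by (rule Metric_space_hdist)

text \<open>The functions with value 1 at \<open>w\<close> form a nonempty closed convex set, and a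
  minimizing sequence in it converges. The minimizer turns out to be a multiple of the kernel at
  \<open>w\<close>.\<close>

lemma minimal_norm_element:
  assumes w: "w \<in> \<Omega>"
  obtains f where "f \<in> H" "f w = 1" "\<And>g. g \<in> H \<Longrightarrow> g w = 1 \<Longrightarrow> Re (ip f f) \<le> Re (ip g g)"
proof -
  define C where "C = {f\<in>H. f w = 1}"
  define d where "d = (INF f\<in>C. Re (ip f f))"
  obtain f0 where f0: "f0 \<in> H" "f0 w \<noteq> 0" using eval_nonzero w by blast
  then have "(\<lambda>z. (1 / f0 w) * f0 z) \<in> C"
    using scale_mem[OF f0(1), of "1 / f0 w"] by (simp add: C_def)
  then have ne: "C \<noteq> {}" by auto
  have bdd: "bdd_below ((\<lambda>f. Re (ip f f)) ` C)"
    by (rule bdd_belowI[of _ 0]) (auto simp: C_def ip_nonneg)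
  have d_le: "d \<le> Re (ip f f)" if "f \<in> C" for f
    unfolding d_def by (rule cINF_lower[OF bdd that])
  have "\<exists>f\<in>C. Re (ip f f) < d + 1 / real (Suc n)" for n
    using cINF_less_iff[OF ne bdd, of "d + 1 / real (Suc n)"] by (simp add: d_def)
  then obtain s where s: "s n \<in> C" "Re (ip (s n) (s n)) < d + 1 / real (Suc n)" for n
    by metis
  have sH: "s n \<in> H" "s n w = 1" for n using s(1)[of n] by (auto simp: C_def)
  have dist: "(hdist H ip (s n) (s m))\<^sup>2 \<le> 2 / real (Suc n) + 2 / real (Suc m)" for n m
  proof -
    \<comment> \<open>Midpoints stay in \<open>C\<close>, so \<open>s n + s m\<close> has square
      norm at least \<open>4 d\<close>. The parallelogram law then bounds the square norm of
      \<open>s n - s m\<close> by \<open>2 (d + 1/(n+1)) + 2 (d + 1/(m+1)) - 4 d\<close>.\<close>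
    have "(\<lambda>z. (1/2) * (s n z + s m z)) \<in> C"
      using scale_mem[OF add_mem[OF sH(1)[of n] sH(1)[of m]], of "1/2"] sH by (simp add: C_def)
    then have "d \<le> Re (ip (\<lambda>z. (1/2) * (s n z + s m z)) (\<lambda>z. (1/2) * (s n z + s m z)))"
      by (rule d_le)
    also have "\<dots> = (1/4) * Re (ip (\<lambda>z. s n z + s m z) (\<lambda>z. s n z + s m z))"
      using ip_scale[OF add_mem[OF sH(1)[of n] sH(1)[of m]] scale_mem[OF add_mem[OF sH(1)[of n] sH(1)[of m]], of "1/2"], of "1/2"]
        ip_scale_right[OF add_mem[OF sH(1)[of n] sH(1)[of m]] add_mem[OF sH(1)[of n] sH(1)[of m]], of "1/2"]
      by (simp add: complex_eq_iff)
    finally show ?thesis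
      using s(2)[of n] s(2)[of m]
      by (simp add: hdist_def sH hnorm_power2 diff_mem ip_self_diff ip_self_add)
  qed
  have "metric.MCauchy s"
    unfolding metric.MCauchy_def
  proof (intro conjI allI impI)
    show "range s \<subseteq> H" using sH by auto
    fix e :: real assume e: "e > 0"
    obtain N :: nat where N: "real N > 4 / e\<^sup>2" using reals_Archimedean2 by blast
    show "\<exists>N. \<forall>n n'. N \<le> n \<longrightarrow> N \<le> n' \<longrightarrow> hdist H ip (s n) (s n') < e"
    proof (intro exI allI impI)
      fix n m assume nm: "N \<le> n" "N \<le> m"
      have "2 / real (Suc n) \<le> 2 / real (Suc N)" "2 / real (Suc m) \<le> 2 / real (Suc N)"
        using nm by (auto intro!: divide_left_mono)
      then have "(hdist H ip (s n) (s m))\<^sup>2 \<le> 4 / real (Suc N)"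
        using dist[of n m] by simp
      also have "\<dots> < e\<^sup>2"
      proof -
        have "4 < real N * e\<^sup>2" using N e by (simp add: divide_less_eq)
        also have "\<dots> \<le> real (Suc N) * e\<^sup>2" using e by (intro mult_right_mono) auto
        finally have "4 < e\<^sup>2 * real (Suc N)" by (simp only: mult.commute)
        then show ?thesis by (simp add: divide_less_eq del: of_nat_Suc)
      qed
      finally show "hdist H ip (s n) (s m) < e"
        using e by (meson less_eq_real_def power_less_imp_less_base)
    qed
  qed
  then obtain f where f: "limitin metric.mtopology s f sequentially"
    using complete by (auto simp: metric.mcomplete_def)
  then have fH: "f \<in> H" by (simp add: metric.limitin_metric)
  \<comment> \<open>Continuity of evaluation is what keeps the limit in \<open>C\<close>.\<close>
  have "((\<lambda>f. f w) \<circ> s) \<longlonglongrightarrow> f w"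
    using continuous_map_limit[OF eval_continuous[OF w] f] by simp
  then have "f w = 1"
    using sH by (simp add: comp_def LIMSEQ_const_iff)
  \<comment> \<open>The triangle inequality compares \<open>f\<close> with \<open>s n\<close>, whose
    norm is at most \<open>sqrt (d + 1/(n+1))\<close>; then \<open>n\<close> tends to
    infinity.\<close>
  moreover have "Re (ip f f) \<le> d"
  proof -
    have d0: "d \<ge> 0" unfolding d_def by (rule cINF_greatest[OF ne]) (auto simp: C_def ip_nonneg)
    have lim: "(\<lambda>n. hdist H ip (s n) f) \<longlonglongrightarrow> 0"
      using f by (simp add: metric.limitin_metric_dist_null)
    have "(\<lambda>n. sqrt (d + 1 / real (Suc n)) + hdist H ip (s n) f) \<longlonglongrightarrow> sqrt (d + 0) + 0"
      by (intro tendsto_intros lim LIMSEQ_inverse_real_of_nat[unfolded inverse_eq_divide])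
    moreover have "hnorm ip f \<le> sqrt (d + 1 / real (Suc n)) + hdist H ip (s n) f" for n
    proof -
      have "hnorm ip f \<le> hnorm ip (s n) + hnorm ip (\<lambda>z. f z - s n z)"
        using hnorm_triangle[OF sH(1)[of n] diff_mem[OF fH sH(1)[of n]]] by simp
      moreover have "hnorm ip (s n) \<le> sqrt (d + 1 / real (Suc n))"
        using s(2)[of n] by (simp add: hnorm_def)
      ultimately show ?thesis
        using hnorm_diff_commute[OF fH sH(1)[of n]] by (simp add: hdist_def fH sH)
    qed
    ultimately have "hnorm ip f \<le> sqrt (d + 0) + 0"
      by (intro LIMSEQ_le_const) auto
    then show ?thesis by (simp add: hnorm_def)
  qed
  ultimately show ?thesis
    using that[OF fH] d_le by (force simp: C_def)
qed

text \<open>Minimality makes \<open>f\<close> orthogonal to every function vanishing at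
  \<open>w\<close>. Since \<open>g - g(w) f\<close> is such a function, \<open>ip g f\<close> equals
  \<open>g w\<close> times the square norm of \<open>f\<close>, and dividing \<open>f\<close> by its
  square norm gives the kernel.\<close>

lemma kernel_exists:
  assumes w: "w \<in> \<Omega>"
  shows "\<exists>k\<in>H. \<forall>f\<in>H. f w = ip f k"
proof -
  obtain f where f: "f \<in> H" "f w = 1"
    and min: "\<And>g. g \<in> H \<Longrightarrow> g w = 1 \<Longrightarrow> Re (ip f f) \<le> Re (ip g g)"
    using minimal_norm_element[OF w] by metis
  have orth: "ip h f = 0" if h: "h \<in> H" "h w = 0" for h
  proof (rule ccontr)
    assume nz: "ip h f \<noteq> 0"
    define c where "c = cmod (ip h f)"
    define Q where "Q = Re (ip h h)"
    have c: "c > 0" and Q: "Q \<ge> 0" using nz h by (auto simp: c_def Q_def ip_nonneg)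
    \<comment> \<open>Subtracting \<open>a h\<close> with \<open>a = t cnj (ip h f)\<close> keeps
      the value at \<open>w\<close> and changes the square norm of \<open>f\<close> by
      \<open>- 2 t c^2 + t^2 c^2 Q\<close>. The conjugate makes the cross term real;
      \<open>t Q < 1\<close> makes the change negative, against minimality. The \<open>+ 1\<close>
      keeps the denominator positive.\<close>
    define t where "t = 1 / (Q + 1)"
    have t: "t > 0" "t * Q < 1" using Q by (auto simp: t_def)
    define a where "a = of_real t * cnj (ip h f)"
    have aH: "(\<lambda>z. a * h z) \<in> H" using h scale_mem by blast
    have e1: "Re (ip f (\<lambda>z. a * h z)) = t * c\<^sup>2"
    proof -
      have "ip (\<lambda>z. a * h z) f = of_real t * (ip h f * cnj (ip h f))"
        using h f by (simp add: ip_scale a_def)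
      also have "\<dots> = of_real (t * c\<^sup>2)"
        by (simp add: c_def flip: complex_norm_square)
      finally show ?thesis using Re_ip_commute[OF f(1) aH] by simp
    qed
    have e2: "Re (ip (\<lambda>z. a * h z) (\<lambda>z. a * h z)) = t\<^sup>2 * c\<^sup>2 * Q"
    proof -
      have "ip (\<lambda>z. a * h z) (\<lambda>z. a * h z) = (a * cnj a) * ip h h"
        using h aH by (simp add: ip_scale ip_scale_right)
      also have "a * cnj a = of_real ((cmod a)\<^sup>2)" by (simp flip: complex_norm_square)
      also have "cmod a = t * c" using t by (simp add: a_def c_def norm_mult)
      finally show ?thesis by (simp add: Q_def power_mult_distrib)
    qed
    have "Re (ip f f) \<le> Re (ip (\<lambda>z. f z - a * h z) (\<lambda>z. f z - a * h z))"
      using f h by (intro min diff_mem aH) auto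
    then have "2 * (t * c\<^sup>2) \<le> t\<^sup>2 * c\<^sup>2 * Q"
      using ip_self_diff[OF f(1) aH] e1 e2 by simp
    then have "(t * c\<^sup>2) * 2 \<le> (t * c\<^sup>2) * (t * Q)" by (simp add: power2_eq_square algebra_simps)
    moreover have "t * c\<^sup>2 > 0" using t c by simp
    ultimately show False using t by (simp add: mult_le_cancel_left)
  qed
  define Q where "Q = Re (ip f f)"
  have Q: "Q \<noteq> 0" using ip_definite[OF f(1)] ip_self[OF f(1)] f(2) by (auto simp: Q_def)
  have "g w = ip g (\<lambda>z. of_real (1 / Q) * f z)" if g: "g \<in> H" for g
  proof -
    have gf: "(\<lambda>z. g w * f z) \<in> H" using f scale_mem by blast
    have "ip (\<lambda>z. g z - g w * f z) f = 0"
      by (rule orth) (use diff_mem[OF g gf] f in auto)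
    then have "ip g f = g w * of_real Q"
      using ip_diff[OF g gf f(1)] f ip_self[OF f(1)] by (simp add: ip_scale Q_def)
    then show ?thesis
      using f g Q by (simp add: ip_scale_right del: of_real_divide) (simp flip: of_real_mult)
  qed
  moreover have "(\<lambda>z. of_real (1 / Q) * f z) \<in> H" using f(1) by (rule scale_mem)
  ultimately show ?thesis by blast
qed

text \<open>The \<open>THE\<close> in the definition needs uniqueness: two representers have the
  same inner product with their difference, so the difference is orthogonal to itself.\<close>

lemma rkernel:
  assumes w: "w \<in> \<Omega>"
  shows rkernel_mem: "rkernel H ip w \<in> H"
    and ip_rkernel: "\<And>f. f \<in> H \<Longrightarrow> ip f (rkernel H ip w) = f w"
proof -
  obtain k where k: "k \<in> H" "\<And>f. f \<in> H \<Longrightarrow> ip f k = f w" using kernel_exists[OF w] by metis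
  have uniq: "k' = k" if k': "k' \<in> H" "\<And>f. f \<in> H \<Longrightarrow> ip f k' = f w" for k'
  proof -
    have D: "(\<lambda>z. k' z - k z) \<in> H" by (rule diff_mem[OF k'(1) k(1)])
    then have "ip (\<lambda>z. k' z - k z) (\<lambda>z. k' z - k z) = 0"
      using ip_diff_right[OF k'(1) k(1) D] k(2)[OF D] k'(2)[OF D] by simp
    then have "(\<lambda>z. k' z - k z) = (\<lambda>z. 0)" by (rule ip_definite[OF D])
    then show ?thesis by (auto simp: fun_eq_iff)
  qed
  have "rkernel H ip w = k"
    unfolding rkernel_def
  proof (rule the_equality)
    show "k \<in> H \<and> (\<forall>f\<in>H. f w = ip f k)" using k by metis
    show "k' = k" if "k' \<in> H \<and> (\<forall>f\<in>H. f w = ip f k')" for k'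
      by (rule uniq) (metis that)+
  qed
  then show "rkernel H ip w \<in> H" "\<And>f. f \<in> H \<Longrightarrow> ip f (rkernel H ip w) = f w"
    by (simp_all only: k)
qed

section \<open>Normalized kernels, the Bessel bound and the Carleson condition\<close>

lemma hnorm_rkernel_pos:
  assumes w: "w \<in> \<Omega>"
  shows "hnorm ip (rkernel H ip w) > 0"
proof -
  obtain f where f: "f \<in> H" "f w \<noteq> 0" using eval_nonzero[OF w] by blast
  have "rkernel H ip w \<noteq> (\<lambda>z. 0)"
    using ip_rkernel[OF w f(1)] ip_scale_right[OF f(1) f(1), of 0] f by auto
  then show ?thesis
    using hnorm_eq_0[OF rkernel_mem[OF w]] hnorm_nonneg[OF rkernel_mem[OF w]] by force
qed

text \<open>A form as a scalar multiple, to which \<open>scale_mem\<close> and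
  \<open>ip_scale_right\<close> apply.\<close>

lemma nkernel_eq:
  "nkernel H ip w = (\<lambda>z. of_real (1 / hnorm ip (rkernel H ip w)) * rkernel H ip w z)"
  by (simp add: nkernel_def)

lemma nkernel_mem: "w \<in> \<Omega> \<Longrightarrow> nkernel H ip w \<in> H"
  unfolding nkernel_eq by (intro scale_mem rkernel_mem)

lemma ip_nkernel:
  "w \<in> \<Omega> \<Longrightarrow> f \<in> H \<Longrightarrow> ip f (nkernel H ip w) = f w / of_real (hnorm ip (rkernel H ip w))"
  by (simp add: nkernel_eq ip_scale_right rkernel_mem ip_rkernel del: of_real_divide)
     (simp add: field_simps)

lemma ip_nkernel_self:
  assumes w: "w \<in> \<Omega>"
  shows "ip (nkernel H ip w) (nkernel H ip w) = 1"
proof -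
  let ?k = "rkernel H ip w" and ?h = "hnorm ip (rkernel H ip w)"
  have "?k w = ip ?k ?k" using ip_rkernel[OF w rkernel_mem[OF w]] by simp
  also have "\<dots> = of_real (?h\<^sup>2)"
    using ip_self[OF rkernel_mem[OF w]] hnorm_power2[OF rkernel_mem[OF w]] by simp
  finally have "?k w = of_real (?h\<^sup>2)" .
  then show ?thesis
    using hnorm_rkernel_pos[OF w] ip_nkernel[OF w nkernel_mem[OF w]]
    by (simp add: nkernel_def power2_eq_square)
qed

text \<open>The synthesis bound passes to the analysis operator by expanding
  \<open>0 \<le> \<parallel>f - g / B\<parallel>\<^sup>2\<close> with \<open>g = (\<Sum>n\<in>F. \<langle>f, x n\<rangle> x n)\<close>.\<close>

lemma bessel_sequence_analysis_bound:
  assumes "bessel_sequence ip I x" and x: "\<And>n. n \<in> I \<Longrightarrow> x n \<in> H"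
  obtains B where "B > 0" "\<And>f F. f \<in> H \<Longrightarrow> finite F \<Longrightarrow> F \<subseteq> I \<Longrightarrow>
    (\<Sum>n\<in>F. (cmod (ip f (x n)))\<^sup>2) \<le> B * Re (ip f f)"
proof -
  from assms(1) obtain B where B: "B > 0" and bound: "\<And>a. finite {n\<in>I. a n \<noteq> 0} \<Longrightarrow>
      (hnorm ip (\<lambda>z. \<Sum>n | n \<in> I \<and> a n \<noteq> 0. a n * x n z))\<^sup>2
        \<le> B * (\<Sum>n | n \<in> I \<and> a n \<noteq> 0. (cmod (a n))\<^sup>2)"
    unfolding bessel_sequence_def by blast
  have "(\<Sum>n\<in>F. (cmod (ip f (x n)))\<^sup>2) \<le> B * Re (ip f f)"
    if f: "f \<in> H" and F: "finite F" "F \<subseteq> I" for f F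
  proof -
    \<comment> \<open>The coefficients are cut off outside \<open>F\<close>, and \<open>G\<close> is
      their support, because the Bessel inequality sums over supports.\<close>
    define a where "a = (\<lambda>n. if n \<in> F then ip f (x n) else 0)"
    define G where "G = {n. n \<in> I \<and> a n \<noteq> 0}"
    define g where "g = (\<lambda>z. \<Sum>n\<in>G. a n * x n z)"
    define S where "S = (\<Sum>n\<in>G. (cmod (a n))\<^sup>2)"
    have G: "G \<subseteq> F" by (auto simp: G_def a_def split: if_splits)
    have finG: "finite G" using G F finite_subset by blast
    have S: "(\<Sum>n\<in>F. (cmod (ip f (x n)))\<^sup>2) = S"
      unfolding S_def using F G by (intro sum.mono_neutral_cong_right) (auto simp: G_def a_def)
    have xG: "x n \<in> H" if "n \<in> G" for n using that x by (auto simp: G_def)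
    have gH: "g \<in> H" and gf: "ip g f = (\<Sum>n\<in>G. a n * ip (x n) f)"
      unfolding g_def using sum_mem_ip_sum[OF finG xG f] by auto
    have "a n * ip (x n) f = of_real ((cmod (a n))\<^sup>2)" if n: "n \<in> G" for n
      using ip_cnj[OF f xG[OF n]] n G complex_norm_square[of "a n"] by (auto simp: a_def)
    then have "ip g f = of_real S"
      unfolding gf S_def of_real_sum by (intro sum.cong) auto
    then have fg: "Re (ip f g) = S" using Re_ip_commute[OF f gH] by simp
    have gg: "Re (ip g g) \<le> B * S"
      using bound[of a] finG hnorm_power2[OF gH] unfolding g_def S_def G_def by simp
    let ?h = "\<lambda>z. of_real (1 / B) * g z"
    have hH: "?h \<in> H" using gH by (rule scale_mem)
    have "0 \<le> Re (ip f f) - 2 * Re (ip f ?h) + Re (ip ?h ?h)"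
      using ip_nonneg[OF diff_mem[OF f hH]] ip_self_diff[OF f hH] by simp
    also have "\<dots> = Re (ip f f) - 2 * S / B + Re (ip g g) / B\<^sup>2"
      using f gH hH fg
      by (simp add: ip_scale ip_scale_right power2_eq_square del: of_real_divide)
    also have "\<dots> \<le> Re (ip f f) - 2 * S / B + (B * S) / B\<^sup>2"
      using gg by (intro add_left_mono divide_right_mono) auto
    also have "\<dots> = Re (ip f f) - S / B" using B by (simp add: power2_eq_square)
    finally show ?thesis using B S by (simp add: field_simps)
  qed
  with B that show ?thesis by blast
qed

text \<open>The measure is the image under \<Lambda> of a weighted counting measure on the naturals.
  Integrability of \<open>|f|^2\<close> thus becomes summability of \<open>|f|^2\<close> at the
  points over the squared kernel norms, whose terms are the squared moduli of the inner products
  with the normalized kernels. Repeated points simply add their masses.\<close>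

lemma carleson_kernel_measure:
  assumes \<Lambda>: "\<And>n. \<Lambda> n \<in> \<Omega>"
    and summable: "\<And>f. f \<in> H \<Longrightarrow> summable (\<lambda>n. (cmod (ip f (nkernel H ip (\<Lambda> n))))\<^sup>2)"
  shows "carleson_measure H (kernel_measure \<Omega> H ip \<Lambda>)"
proof -
  define u where "u n = 1 / (hnorm ip (rkernel H ip (\<Lambda> n)))\<^sup>2" for n
  define D where "D = density (count_space UNIV) (\<lambda>n. ennreal (u n))"
  define M where "M = distr D (count_space \<Omega>) \<Lambda>"
  have \<Lambda>_meas: "\<Lambda> \<in> measurable D (count_space \<Omega>)" using \<Lambda> by (auto simp: D_def)
  have em: "emeasure M A = (\<Sum>n. ennreal (u n) * emeasure (return (count_space \<Omega>) (\<Lambda> n)) A)"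
    if "A \<subseteq> \<Omega>" for A
  proof -
    have "emeasure M A = emeasure D (\<Lambda> -` A)"
      using that \<Lambda>_meas by (simp add: M_def emeasure_distr D_def)
    also have "\<dots> = (\<Sum>n. ennreal (u n) * indicator (\<Lambda> -` A) n)"
      by (simp add: D_def emeasure_density nn_integral_count_space_nat)
    finally show ?thesis using that by (simp add: indicator_vimage)
  qed
  \<comment> \<open>Agreement on subsets of \<Omega> suffices for \<open>measure_of\<close>.
    Countable additivity of the defining set function comes from \<open>M\<close> being a
    measure.\<close>
  have "kernel_measure \<Omega> H ip \<Lambda> = measure_of \<Omega> (Pow \<Omega>) (emeasure M)"
    unfolding kernel_measure_def u_def[symmetric]
  proof (rule measure_of_eq)
    fix A assume "A \<in> sigma_sets \<Omega> (Pow \<Omega>)"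
    then have "A \<subseteq> \<Omega>" using sigma_sets_into_sp[of "Pow \<Omega>" \<Omega> A] by blast
    then show "(\<Sum>n. ennreal (u n) * emeasure (return (count_space \<Omega>) (\<Lambda> n)) A) = emeasure M A"
      by (simp add: em)
  qed simp
  also have "\<dots> = M" using measure_of_of_measure[of M] by (simp add: M_def)
  finally have eq: "kernel_measure \<Omega> H ip \<Lambda> = M" .
  show ?thesis
    unfolding carleson_measure_def eq
  proof (intro ballI conjI)
    fix f assume f: "f \<in> H"
    show "f \<in> borel_measurable M" by (simp add: M_def)
    have "(cmod (ip f (nkernel H ip (\<Lambda> n))))\<^sup>2 = u n * (cmod (f (\<Lambda> n)))\<^sup>2" for n
      using hnorm_rkernel_pos[OF \<Lambda>] \<Lambda> f
      by (simp add: ip_nkernel u_def norm_divide power_divide)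
    then have "summable (\<lambda>n. norm (u n * (cmod (f (\<Lambda> n)))\<^sup>2))"
      using summable[OF f] by (simp add: u_def)
    then have "integrable D (\<lambda>n. (cmod (f (\<Lambda> n)))\<^sup>2)"
      unfolding D_def by (subst integrable_density)
        (auto simp: u_def integrable_count_space_nat_iff)
    then show "integrable M (\<lambda>z. (cmod (f z))\<^sup>2)"
      unfolding M_def by (subst integrable_distr_eq[OF \<Lambda>_meas]) auto
  qed
qed

end

section \<open>Riesz families, greedy colouring and assembling a partition\<close>

lemma riesz_sequence_reindex:
  assumes e: "bij_betw e J I" and R: "riesz_sequence ip J (\<lambda>n. x (e n))"
  shows "riesz_sequence ip I x"
proof -
  obtain A B where "A > 0" "B > 0" and AB: "\<And>a. finite {n\<in>J. a n \<noteq> 0} \<Longrightarrow>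
      A * (\<Sum>n | n \<in> J \<and> a n \<noteq> 0. (cmod (a n))\<^sup>2)
        \<le> (hnorm ip (\<lambda>z. \<Sum>n | n \<in> J \<and> a n \<noteq> 0. a n * x (e n) z))\<^sup>2 \<and>
      (hnorm ip (\<lambda>z. \<Sum>n | n \<in> J \<and> a n \<noteq> 0. a n * x (e n) z))\<^sup>2
        \<le> B * (\<Sum>n | n \<in> J \<and> a n \<noteq> 0. (cmod (a n))\<^sup>2)"
    using R unfolding riesz_sequence_def by blast
  show ?thesis
    unfolding riesz_sequence_def
  proof (rule exI[of _ A], rule conjI, fact, rule exI[of _ B], rule conjI, fact, intro allI impI)
    fix a :: "'b \<Rightarrow> complex"
    assume fin: "finite {n\<in>I. a n \<noteq> 0}"
    let ?S = "{n. n \<in> J \<and> a (e n) \<noteq> 0}"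
    \<comment> \<open>The bijection restricts to the supports, so all sums coincide and the
      constants \<open>A\<close> and \<open>B\<close> carry over.\<close>
    have bij: "bij_betw e ?S {n. n \<in> I \<and> a n \<noteq> 0}"
      using e by (auto simp: bij_betw_def inj_on_def)
    have "finite ?S" using bij_betw_finite[OF bij] fin by simp
    moreover have "(\<Sum>n | n \<in> I \<and> a n \<noteq> 0. (cmod (a n))\<^sup>2) = (\<Sum>n\<in>?S. (cmod (a (e n)))\<^sup>2)"
      "\<And>z. (\<Sum>n | n \<in> I \<and> a n \<noteq> 0. a n * x n z) = (\<Sum>n\<in>?S. a (e n) * x (e n) z)"
      by (simp_all add: sum.reindex_bij_betw[OF bij, symmetric])
    ultimately show "A * (\<Sum>n | n \<in> I \<and> a n \<noteq> 0. (cmod (a n))\<^sup>2)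
        \<le> (hnorm ip (\<lambda>z. \<Sum>n | n \<in> I \<and> a n \<noteq> 0. a n * x n z))\<^sup>2 \<and>
      (hnorm ip (\<lambda>z. \<Sum>n | n \<in> I \<and> a n \<noteq> 0. a n * x n z))\<^sup>2
        \<le> B * (\<Sum>n | n \<in> I \<and> a n \<noteq> 0. (cmod (a n))\<^sup>2)"
      using AB[of "\<lambda>n. a (e n)"] by simp
  qed
qed

text \<open>For a unit vector, the norm of a multiple is the modulus of its coefficient, so both
  constants are 1.\<close>

lemma (in hilbert_function_space) riesz_sequence_singleton:
  assumes "x n \<in> H" "ip (x n) (x n) = 1"
  shows "riesz_sequence ip {n} x"
  unfolding riesz_sequence_def
proof (rule exI[of _ 1], rule conjI, simp, rule exI[of _ 1], rule conjI, simp, intro allI impI)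
  fix a :: "'b \<Rightarrow> complex"
  let ?S = "{m. m \<in> {n} \<and> a m \<noteq> 0}"
  have "?S = (if a n = 0 then {} else {n})" by auto
  moreover have "(hnorm ip (\<lambda>z. a n * x n z))\<^sup>2 = (cmod (a n))\<^sup>2"
  proof -
    have "ip (\<lambda>z. a n * x n z) (\<lambda>z. a n * x n z) = a n * cnj (a n)"
      using assms by (simp add: ip_scale ip_scale_right scale_mem)
    then show ?thesis
      by (simp add: hnorm_power2[OF scale_mem[OF assms(1)]] flip: complex_norm_square)
  qed
  moreover have "hnorm ip (\<lambda>z. 0) = 0"
    by (simp add: hnorm_def ip_zero_left zero_mem)
  ultimately show "1 * (\<Sum>m\<in>?S. (cmod (a m))\<^sup>2)
      \<le> (hnorm ip (\<lambda>z. \<Sum>m\<in>?S. a m * x m z))\<^sup>2 \<and>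
    (hnorm ip (\<lambda>z. \<Sum>m\<in>?S. a m * x m z))\<^sup>2 \<le> 1 * (\<Sum>m\<in>?S. (cmod (a m))\<^sup>2)"
    by auto
qed

text \<open>Colours are chosen in increasing order of \<open>n\<close>: the earlier neighbours
  occupy at most \<open>K\<close> of the \<open>K + 1\<close> colours \<open>0..K\<close>, so one is
  free.\<close>

lemma greedy_colouring:
  fixes E :: "nat \<Rightarrow> nat \<Rightarrow> bool"
  assumes "\<And>n. card {m. m < n \<and> E n m} \<le> K"
  obtains c where "\<And>n. c n \<le> K" "\<And>m n. m < n \<Longrightarrow> E n m \<Longrightarrow> c m \<noteq> c n"
proof -
  have "\<exists>c. \<forall>n. c n \<le> K \<and> (\<forall>m<n. E n m \<longrightarrow> c m \<noteq> c n)"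
  proof (rule dependent_wellorder_choice)
    fix n and c :: "nat \<Rightarrow> nat"
    have "card (c ` {m. m < n \<and> E n m}) \<le> K"
      using assms[of n] card_image_le[of "{m. m < n \<and> E n m}" c] by simp
    then have "\<not> {..K} \<subseteq> c ` {m. m < n \<and> E n m}"
      using card_mono[of "c ` {m. m < n \<and> E n m}" "{..K}"] by auto
    then show "\<exists>r. r \<le> K \<and> (\<forall>m<n. E n m \<longrightarrow> c m \<noteq> r)" by auto
  qed auto
  then show ?thesis using that by blast
qed

text \<open>Allows the blocks to be given as a set. Numbering them injectively turns disjointness of
  distinct members into disjointness of the indexed family.\<close>

lemma finite_union_of_rieszI:
  assumes "finite P" "\<Union>P = UNIV" "disjoint P" "\<And>I. I \<in> P \<Longrightarrow> riesz_sequence ip I x"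
  shows "finite_union_of_riesz ip x"
proof -
  obtain h where h: "bij_betw h {0..<card P} P"
    using ex_bij_betw_nat_finite[OF assms(1)] by blast
  then have img: "h ` {..<card P} = P" and inj: "inj_on h {..<card P}"
    by (auto simp: bij_betw_def atLeast0LessThan)
  have "disjoint_family_on h {..<card P}"
    using disjoint_image_disjoint_family_on[OF _ inj] assms(3) img by simp
  then show ?thesis
    unfolding finite_union_of_riesz_def using assms img by (intro exI[of _ "card P"] exI[of _ h]) auto
qed

section \<open>From ACSC to the partition into Riesz sequences\<close>

theorem mainTheorem3:
  assumes ACSC: "\<forall>(\<Omega> :: 'a set) H ip (\<Lambda> :: nat \<Rightarrow> 'a).
      complete_NP_space \<Omega> H ip \<longrightarrow> (\<forall>n. \<Lambda> n \<in> \<Omega>) \<longrightarrow>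
      separated_sequence H ip \<Lambda> \<longrightarrow> carleson_measure H (kernel_measure \<Omega> H ip \<Lambda>) \<longrightarrow>
      interpolating H ip \<Lambda>"
  shows FC_for_kernels: "\<forall>(\<Omega> :: 'a set) H ip (\<Lambda> :: nat \<Rightarrow> 'a).
      complete_NP_space \<Omega> H ip \<longrightarrow> (\<forall>n. \<Lambda> n \<in> \<Omega>) \<longrightarrow>
      bessel_sequence ip UNIV (\<lambda>n. nkernel H ip (\<Lambda> n)) \<longrightarrow>
      finite_union_of_riesz ip (\<lambda>n. nkernel H ip (\<Lambda> n))"
proof (intro allI impI)
  fix \<Omega> :: "'a set" and H ip and \<Lambda> :: "nat \<Rightarrow> 'a"
  assume NP: "complete_NP_space \<Omega> H ip" and \<Lambda>: "\<forall>n. \<Lambda> n \<in> \<Omega>"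
    and bessel: "bessel_sequence ip UNIV (\<lambda>n. nkernel H ip (\<Lambda> n))"
  interpret hilbert_function_space \<Omega> H ip using NP by (simp add: complete_NP_space_def)
  let ?x = "\<lambda>n. nkernel H ip (\<Lambda> n)"
  have x: "?x n \<in> H" "ip (?x n) (?x n) = 1" for n
    using \<Lambda> by (auto simp: nkernel_mem ip_nkernel_self)
  obtain B where B: "B > 0" and bound: "\<And>f F. f \<in> H \<Longrightarrow> finite F \<Longrightarrow>
      (\<Sum>n\<in>F. (cmod (ip f (?x n)))\<^sup>2) \<le> B * Re (ip f f)"
    using bessel_sequence_analysis_bound[OF bessel] x by (metis subset_UNIV)
  \<comment> \<open>Any threshold strictly between 0 and 1 would serve; it becomes the separation
    constant of each colour class.\<close>
  define E where "E = (\<lambda>n m. cmod (ip (?x n) (?x m)) > 1/2)"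
  have "card {m. m < n \<and> E n m} \<le> nat \<lceil>4 * B\<rceil>" for n
  proof -
    let ?F = "{m. m < n \<and> E n m}"
    have "real (card ?F) * (1/2)\<^sup>2 = (\<Sum>m\<in>?F. (1/2)\<^sup>2)" by simp
    also have "\<dots> \<le> (\<Sum>m\<in>?F. (cmod (ip (?x n) (?x m)))\<^sup>2)"
      by (intro sum_mono power_mono) (auto simp: E_def)
    also have "\<dots> \<le> B" using bound[of "?x n" ?F] x by simp
    finally have "real (card ?F) \<le> 4 * B" by (simp add: power2_eq_square)
    then show ?thesis by linarith
  qed
  then obtain c where c: "\<And>n. c n \<le> nat \<lceil>4 * B\<rceil>" "\<And>m n. m < n \<Longrightarrow> E n m \<Longrightarrow> c m \<noteq> c n"
    by (rule greedy_colouring[of E]) blast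
  have sep: "cmod (ip (?x n) (?x m)) \<le> 1/2" if "n \<noteq> m" "c n = c m" for n m
  proof -
    have "cmod (ip (?x n) (?x m)) = cmod (ip (?x m) (?x n))"
      using ip_cnj[OF x(1) x(1), of m n] by simp
    \<comment> \<open>The colouring only excludes edges from the larger index to the smaller; the
      equality of moduli transfers the bound to either order.\<close>
    moreover have "\<not> E n m \<or> \<not> E m n" using c(2)[of n m] c(2)[of m n] that by linarith
    ultimately show ?thesis by (auto simp: E_def)
  qed
  define cl where "cl = (\<lambda>j. c -` {j})"
  have riesz_inf: "riesz_sequence ip (cl j) ?x" if inf: "infinite (cl j)" for j
  proof -
    \<comment> \<open>ACSC concerns sequences indexed by all naturals, so an infinite class is
      enumerated first and the conclusion is carried back along \<open>e\<close>.\<close>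
    define e where "e = enumerate (cl j)"
    have e: "bij_betw e UNIV (cl j)" unfolding e_def by (rule bij_enumerate[OF inf])
    then have inj: "inj e" and ec: "\<And>n. c (e n) = j" by (auto simp: bij_betw_def cl_def)
    have "separated_sequence H ip (\<lambda>n. \<Lambda> (e n))"
      unfolding separated_sequence_def
      using sep ec inj by (intro exI[of _ "1/2"]) (auto simp: inj_eq)
    moreover have "carleson_measure H (kernel_measure \<Omega> H ip (\<lambda>n. \<Lambda> (e n)))"
    proof (rule carleson_kernel_measure)
      fix f assume f: "f \<in> H"
      \<comment> \<open>As \<open>e\<close> is injective, a partial sum along the class is a sum
        over a finite set of distinct original indices, so the same bound applies.\<close>
      have "(\<Sum>i<n. (cmod (ip f (?x (e i))))\<^sup>2) \<le> B * Re (ip f f)" for n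
        using bound[OF f, of "e ` {..<n}"] inj
        by (simp add: sum.reindex inj_on_subset[OF inj])
      then show "summable (\<lambda>n. (cmod (ip f (?x (e n))))\<^sup>2)"
        by (intro summableI_nonneg_bounded[where x = "B * Re (ip f f)"]) auto
    qed (use \<Lambda> in auto)
    ultimately have "interpolating H ip (\<lambda>n. \<Lambda> (e n))"
      using ACSC[rule_format, OF NP, of "\<lambda>n. \<Lambda> (e n)"] \<Lambda> by simp
    then show ?thesis
      unfolding interpolating_def by (intro riesz_sequence_reindex[OF e]) simp
  qed
  \<comment> \<open>ACSC says nothing about finite families, so finite colour classes are cut into singletons.\<close>
  define J where "J = {j. j \<le> nat \<lceil>4 * B\<rceil>}"
  define S where "S = {n. finite (cl (c n))}"
  \<comment> \<open>A colour that never occurs has an empty, hence finite, class and contributes no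
    block.\<close>
  define P where "P = cl ` {j\<in>J. infinite (cl j)} \<union> (\<lambda>n. {n}) ` S"
  show "finite_union_of_riesz ip ?x"
  proof (rule finite_union_of_rieszI)
    have "S \<subseteq> (\<Union>j\<in>{j\<in>J. finite (cl j)}. cl j)" using c(1) by (auto simp: S_def J_def cl_def)
    then have "finite S" by (rule finite_subset) (auto simp: J_def)
    then show "finite P" by (simp add: P_def J_def)
    show "\<Union>P = UNIV"
      using c(1) by (auto simp: P_def J_def S_def cl_def)
    show "disjoint P"
      by (auto simp: disjoint_def P_def S_def cl_def)
    show "riesz_sequence ip I ?x" if "I \<in> P" for I
      using that riesz_inf riesz_sequence_singleton[of ?x] x by (auto simp: P_def)
  qed
qed

end
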